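(* Let $\sigma$ be a skew shape with $n$ boxes. (i) The expected value of the last entry of the first row of a uniformly chosen skew standard Young tableau of shape $\sigma$ is $n+1-f^{\sigma^1}/f^{\sigma}$, where $\sigma^1$ denotes the skew shape obtained from $\sigma$ by adding a box to the first row on the right. (ii) More generally, suppose $b=(i,j)$ is the last box of the $i$-th row of $\sigma$, and suppose the box $c=(i-1,j+1)$ due northeast of $b$ also lies in $\sigma$. Then the expected value of the maximum of the entries in boxes $b$ and $c$ of a uniformly chosen skew standard Young tableau of shape $\sigma$ is $n+1-f^{\sigma^i}/f^{\sigma}$, where $\sigma^i$ denotes the skew shape obtained from $\sigma$ by adding a box to the $i$-th row on the right.
   Context: For partitions $\lambda=(\lambda_1\ge\cdots\ge\lambda_k>0)$ and $\mu$ with $\mu_i\le\lambda_i$ for all $i$ (missing parts are $0$), the skew shape $\sigma=\lambda\setminus\mu$ consists of the boxes $(i,j)$ (row $i$ from the top, column $j$ from the left) with $\mu_i<j\le\lambda_i$. A skew standard Young tableau of shape $\sigma$ with $n$ boxes is a bijective filling of its boxes with $1,\ldots,n$, strictly increasing along each row (left to right) and each column (top to bottom). $f^\sigma$ is the number of skew standard Young tableaux of shape $\sigma$. *)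

theory Defs
  imports "HOL-Probability.Probability"
begin

definition is_partition :: "nat list \<Rightarrow> bool" where
  "is_partition l \<longleftrightarrow> sorted_wrt (\<ge>) l \<and> (\<forall>x \<in> set l. 0 < x)"

text \<open>Parts are numbered from 1; missing parts, including the fictitious part number 0, are 0.\<close>

definition part :: "nat list \<Rightarrow> nat \<Rightarrow> nat" where
  "part l i = (if 1 \<le> i \<and> i \<le> length l then l ! (i - 1) else 0)"

definition skew_diagram :: "nat list \<Rightarrow> nat list \<Rightarrow> (nat \<times> nat) set" where
  "skew_diagram l m = {(i, j). part m i < j \<and> j \<le> part l i}"

definition is_skew_shape :: "(nat \<times> nat) set \<Rightarrow> bool" where
  "is_skew_shape S \<longleftrightarrow>
     (\<exists>l m. is_partition l \<and> is_partition m \<and> (\<forall>i. part m i \<le> part l i) \<and> S = skew_diagram l m)"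

text \<open>Fillings are functions that are undefined outside the shape, so that distinct
  tableaux are distinct functions and can be counted.\<close>

definition skew_syt :: "(nat \<times> nat) set \<Rightarrow> (nat \<times> nat \<Rightarrow> nat) set" where
  "skew_syt S = {T \<in> extensional S. bij_betw T S {1..card S} \<and>
     (\<forall>i j j'. (i, j) \<in> S \<longrightarrow> (i, j') \<in> S \<longrightarrow> j < j' \<longrightarrow> T (i, j) < T (i, j')) \<and>
     (\<forall>i i' j. (i, j) \<in> S \<longrightarrow> (i', j) \<in> S \<longrightarrow> i < i' \<longrightarrow> T (i, j) < T (i', j))}"

definition num_syt :: "(nat \<times> nat) set \<Rightarrow> nat" where
  "num_syt S = card (skew_syt S)"

definition shape_row :: "(nat \<times> nat) set \<Rightarrow> nat \<Rightarrow> nat set" where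
  "shape_row S i = {j. (i, j) \<in> S}"

text \<open>Column of the last box of a row; only meaningful for nonempty rows.\<close>

definition last_col :: "(nat \<times> nat) set \<Rightarrow> nat \<Rightarrow> nat" where
  "last_col S i = Max (shape_row S i)"

definition add_box :: "(nat \<times> nat) set \<Rightarrow> nat \<Rightarrow> (nat \<times> nat) set" where
  "add_box S i = insert (i, last_col S i + 1) S"

definition syt_expectation :: "(nat \<times> nat) set \<Rightarrow> ((nat \<times> nat \<Rightarrow> nat) \<Rightarrow> nat) \<Rightarrow> real" where
  "syt_expectation S X = measure_pmf.expectation (pmf_of_set (skew_syt S)) (\<lambda>T. real (X T))"

lemma shape_row_skew_diagram: "shape_row (skew_diagram l m) i = {part m i<..part l i}"
  by (auto simp: shape_row_def skew_diagram_def)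

lemma last_col_skew_diagram:
  assumes "shape_row (skew_diagram l m) i \<noteq> {}"
  shows "last_col (skew_diagram l m) i = part l i"
  using assms unfolding last_col_def shape_row_skew_diagram
  by (intro Max_eqI) auto

text \<open>On a nonempty row, adding a box raises the corresponding part of the outer partition by 1.\<close>

lemma add_box_skew_diagram:
  assumes "shape_row (skew_diagram l m) i \<noteq> {}"
  shows "add_box (skew_diagram l m) i = skew_diagram (l[i - 1 := l ! (i - 1) + 1]) m"
proof -
  have i: "1 \<le> i" "i \<le> length l" and lt: "part m i < part l i"
    using assms by (auto simp: shape_row_skew_diagram part_def split: if_splits)
  have *: "part (l[i - 1 := l ! (i - 1) + 1]) k = (if k = i then part l i + 1 else part l k)" for k
    using i by (auto simp: part_def nth_list_update)
  show ?thesis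
    unfolding add_box_def last_col_skew_diagram[OF assms]
    unfolding skew_diagram_def * using lt by (auto split: if_splits)
qed

lemma is_skew_shape_add_box:
  assumes "is_skew_shape S" and ne: "shape_row S i \<noteq> {}"
    and ok: "i = 1 \<or> (i - 1, last_col S i + 1) \<in> S"
  shows "is_skew_shape (add_box S i)"
proof -
  obtain l m where l: "is_partition l" and m: "is_partition m"
    and le: "\<And>k. part m k \<le> part l k" and S: "S = skew_diagram l m"
    using assms(1) unfolding is_skew_shape_def by auto
  define l' where "l' = l[i - 1 := l ! (i - 1) + 1]"
  have i: "1 \<le> i" "i \<le> length l"
    using ne unfolding S by (auto simp: shape_row_skew_diagram part_def split: if_splits)
  have part_l': "part l' k = (if k = i then part l i + 1 else part l k)" for k
    unfolding l'_def using i by (auto simp: part_def nth_list_update)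
  have above: "i = 1 \<or> part l i + 1 \<le> part l (i - 1)"
    using ok last_col_skew_diagram ne unfolding S by (auto simp: skew_diagram_def)
  have nth_above: "l ! (i - 1) < l ! a" if "a < i - 1" for a
  proof -
    have "l ! (i - 1) < l ! (i - 2)"
      using above i that by (auto simp: part_def numeral_2_eq_2 split: if_splits)
    also have "l ! (i - 2) \<le> l ! a"
      using l i that unfolding is_partition_def sorted_wrt_iff_nth_less
      by (cases "a = i - 2") auto
    finally show ?thesis .
  qed
  have "sorted_wrt (\<ge>) l'"
    unfolding sorted_wrt_iff_nth_less
  proof (intro allI impI)
    fix a b assume ab: "a < b" "b < length l'"
    then have "l ! b \<le> l ! a"
      using l unfolding is_partition_def sorted_wrt_iff_nth_less l'_def by auto
    then show "l' ! b \<le> l' ! a"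
      using nth_above[of a] ab i by (auto simp: l'_def nth_list_update Suc_le_eq)
  qed
  moreover have "\<forall>x \<in> set l'. 0 < x"
    using l set_update_subset_insert[of l "i - 1" "l ! (i - 1) + 1"]
    unfolding is_partition_def l'_def by auto
  ultimately have "is_partition l'"
    by (simp add: is_partition_def)
  moreover have "\<forall>k. part m k \<le> part l' k"
    using le by (auto simp: part_l' le_Suc_eq)
  ultimately show ?thesis
    using m add_box_skew_diagram ne unfolding S l'_def is_skew_shape_def by blast
qed

end

theory Submission
  imports Defs
begin

text \<open>A standard filling of the shape enlarged by a maximal box \<open>d\<close> is the same as a standard
  filling \<open>T\<close> of the original shape together with the value \<open>k\<close> at \<open>d\<close>: entries \<open>\<ge> k\<close> of \<open>T\<close> are
  shifted up by one. The only constraint is that \<open>k\<close> exceeds the largest entry \<open>m T\<close> among the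
  neighbours of \<open>d\<close>, so there are \<open>n + 1 - m T\<close> choices. Averaging over \<open>T\<close> gives the claim.\<close>

section \<open>Linear extensions of a relation on a finite set\<close>

definition linear_exts :: "('a \<Rightarrow> 'a \<Rightarrow> bool) \<Rightarrow> 'a set \<Rightarrow> ('a \<Rightarrow> nat) set" where
  "linear_exts r A = {T \<in> extensional A. bij_betw T A {1..card A} \<and>
     (\<forall>x\<in>A. \<forall>y\<in>A. r x y \<longrightarrow> T x < T y)}"

lemma finite_linear_exts:
  assumes "finite A"
  shows "finite (linear_exts r A)"
proof (rule finite_subset)
  show "linear_exts r A \<subseteq> A \<rightarrow>\<^sub>E {1..card A}"
    by (auto simp: linear_exts_def PiE_def bij_betw_def)
qed (use assms in \<open>auto intro: finite_PiE\<close>)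

section \<open>Shifting values around a gap\<close>

definition skip :: "nat \<Rightarrow> nat \<Rightarrow> nat" where
  "skip k v = (if v < k then v else v + 1)"

text \<open>Left inverse of \<open>skip k\<close>, which enumerates the naturals other than
  \<open>k\<close> in increasing order. At \<open>k\<close> itself the value carries no meaning,
  whence the side conditions \<open>v \<noteq> k\<close> below.\<close>

definition unskip :: "nat \<Rightarrow> nat \<Rightarrow> nat" where
  "unskip k v = (if v < k then v else v - 1)"

lemma unskip_skip [simp]: "unskip k (skip k v) = v"
  by (simp add: skip_def unskip_def)

lemma skip_unskip [simp]: "v \<noteq> k \<Longrightarrow> skip k (unskip k v) = v"
  by (auto simp: skip_def unskip_def)

lemma skip_less_iff [simp]: "skip k u < skip k v \<longleftrightarrow> u < v"
  by (auto simp: skip_def)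

lemma skip_less_self_iff [simp]: "skip k v < k \<longleftrightarrow> v < k"
  by (auto simp: skip_def)

lemma unskip_less_self_iff: "v \<noteq> k \<Longrightarrow> unskip k v < k \<longleftrightarrow> v < k"
  by (auto simp: unskip_def)

lemma bij_betw_skip:
  assumes "k \<in> {1..Suc n}"
  shows "bij_betw (skip k) {1..n} ({1..Suc n} - {k})"
  by (rule bij_betw_byWitness[where f' = "unskip k"])
    (use assms in \<open>auto simp: skip_def unskip_def\<close>)

lemma bij_betw_unskip:
  assumes "k \<in> {1..Suc n}"
  shows "bij_betw (unskip k) ({1..Suc n} - {k}) {1..n}"
  by (rule bij_betw_byWitness[where f' = "skip k"])
    (use assms in \<open>auto simp: skip_def unskip_def\<close>)

section \<open>Inserting and removing a maximal element\<close>

definition insert_value :: "'a set \<Rightarrow> 'a \<Rightarrow> ('a \<Rightarrow> nat) \<times> nat \<Rightarrow> 'a \<Rightarrow> nat" where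
  "insert_value A d = (\<lambda>(T, k). (restrict (skip k \<circ> T) A)(d := k))"

definition remove_value :: "'a set \<Rightarrow> 'a \<Rightarrow> ('a \<Rightarrow> nat) \<Rightarrow> ('a \<Rightarrow> nat) \<times> nat" where
  "remove_value A d T = (restrict (unskip (T d) \<circ> T) A, T d)"

text \<open>Relations inside \<open>A\<close> survive because \<open>skip k\<close> is strictly
  increasing. Nothing lies above \<open>d\<close>, and an element below \<open>d\<close> has a value
  less than \<open>k\<close>, which \<open>skip k\<close> leaves unchanged.\<close>

lemma insert_value_linear_ext:
  assumes A: "finite A" "d \<notin> A"
    and max: "\<not> r d d" "\<And>x. x \<in> A \<Longrightarrow> \<not> r d x"
    and T: "T \<in> linear_exts r A" and k: "k \<in> {1..Suc (card A)}"
    and below: "\<And>x. x \<in> A \<Longrightarrow> r x d \<Longrightarrow> T x < k"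
  shows "insert_value A d (T, k) \<in> linear_exts r (insert d A)"
proof -
  let ?U = "insert_value A d (T, k)"
  have U: "?U d = k" "\<And>x. x \<in> A \<Longrightarrow> ?U x = skip k (T x)"
    using A by (auto simp: insert_value_def)
  have bT: "bij_betw T A {1..card A}"
    and mT: "\<And>x y. x \<in> A \<Longrightarrow> y \<in> A \<Longrightarrow> r x y \<Longrightarrow> T x < T y"
    using T by (auto simp: linear_exts_def)
  have "bij_betw (skip k \<circ> T) A ({1..Suc (card A)} - {k})"
    using bT bij_betw_skip[OF k] by (rule bij_betw_trans)
  then have "bij_betw ?U A ({1..Suc (card A)} - {k})"
    by (subst bij_betw_cong[where g = "skip k \<circ> T"]) (auto simp: U)
  then have "bij_betw ?U (A \<union> {d}) (({1..Suc (card A)} - {k}) \<union> {k})"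
    by (rule bij_betw_combine) (auto simp: bij_betw_def U)
  moreover have "({1..Suc (card A)} - {k}) \<union> {k} = {1..Suc (card A)}"
    using k by auto
  ultimately have "bij_betw ?U (insert d A) {1..card (insert d A)}"
    using A by simp
  moreover have "?U \<in> extensional (insert d A)"
    by (auto simp: insert_value_def extensional_def)
  moreover have "?U x < ?U y" if "x \<in> insert d A" "y \<in> insert d A" "r x y" for x y
    using that max below mT by (auto simp: U)
  ultimately show ?thesis
    unfolding linear_exts_def by blast
qed

text \<open>Injectivity of \<open>U\<close> keeps the value \<open>U d\<close> away from
  \<open>A\<close>, so closing the gap at \<open>U d\<close> loses no information. The third claim
  records this for the proof that insertion undoes removal.\<close>

lemma remove_value_linear_ext:
  assumes A: "finite A" "d \<notin> A" and U: "U \<in> linear_exts r (insert d A)"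
  shows "restrict (unskip (U d) \<circ> U) A \<in> linear_exts r A" (is "?T \<in> _")
    and "U d \<in> {1..Suc (card A)}"
    and "\<And>x. x \<in> A \<Longrightarrow> U x \<noteq> U d"
proof -
  have bU: "bij_betw U (insert d A) {1..Suc (card A)}"
    and mU: "\<And>x y. x \<in> A \<Longrightarrow> y \<in> A \<Longrightarrow> r x y \<Longrightarrow> U x < U y"
    using U A by (auto simp: linear_exts_def)
  show d: "U d \<in> {1..Suc (card A)}"
    using bU by (auto simp: bij_betw_def)
  show ne: "U x \<noteq> U d" if "x \<in> A" for x
    using bU that A by (auto simp: bij_betw_def inj_on_def)
  have "bij_betw U A ({1..Suc (card A)} - {U d})"
    using bij_betw_DiffI[OF bU, of "{d}" "{U d}"] A d by (simp add: bij_betw_def)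
  then have "bij_betw (unskip (U d) \<circ> U) A {1..card A}"
    using bij_betw_unskip[OF d] by (rule bij_betw_trans)
  then have "bij_betw ?T A {1..card A}"
    by (subst bij_betw_cong[where g = "unskip (U d) \<circ> U"]) auto
  moreover have "?T x < ?T y" if "x \<in> A" "y \<in> A" "r x y" for x y
  proof -
    \<comment> \<open>\<open>unskip\<close> is not strictly increasing across the gap, so the
      comparison is made after \<open>skip\<close>, which restores \<open>U x\<close> and
      \<open>U y\<close> and reflects the strict order.\<close>
    have "skip (U d) (?T x) < skip (U d) (?T y)"
      using mU[OF that] ne that by simp
    then show ?thesis by simp
  qed
  ultimately show "?T \<in> linear_exts r A"
    by (auto simp: linear_exts_def)
qed

text \<open>The function \<open>m\<close> is specified only through its strict upper bounds. This
  avoids a maximum over the set of predecessors of \<open>d\<close> and lets each application choose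
  its own formula for \<open>m\<close>.\<close>

lemma card_linear_exts_insert:
  assumes A: "finite A" "d \<notin> A"
    and max: "\<not> r d d" "\<And>x. x \<in> A \<Longrightarrow> \<not> r d x"
    and m: "\<And>T k. T \<in> linear_exts r A \<Longrightarrow> (\<forall>x\<in>A. r x d \<longrightarrow> T x < k) \<longleftrightarrow> m T < k"
  shows "card (linear_exts r (insert d A)) = (\<Sum>T\<in>linear_exts r A. Suc (card A) - m T)"
proof -
  \<comment> \<open>For fixed \<open>T\<close> the admissible values at \<open>d\<close> are those
    exceeding \<open>m T\<close>, up to the new size; this interval has
    \<open>Suc (card A) - m T\<close> elements, also when it is empty.\<close>
  let ?P = "SIGMA T:linear_exts r A. {Suc (m T)..Suc (card A)}"
  have "bij_betw (insert_value A d) ?P (linear_exts r (insert d A))"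
  proof (rule bij_betw_byWitness[where f' = "remove_value A d"])
    show "\<forall>p\<in>?P. remove_value A d (insert_value A d p) = p"
      using A by (auto simp: insert_value_def remove_value_def linear_exts_def fun_eq_iff
          restrict_def extensional_def)
    show "\<forall>U\<in>linear_exts r (insert d A). insert_value A d (remove_value A d U) = U"
    proof
      fix U assume U: "U \<in> linear_exts r (insert d A)"
      then have "U x = undefined" if "x \<notin> insert d A" for x
        using that by (auto simp: linear_exts_def extensional_def)
      then show "insert_value A d (remove_value A d U) = U"
        using remove_value_linear_ext(3)[OF A U]
        by (auto simp: insert_value_def remove_value_def fun_eq_iff)
    qed
    show "insert_value A d ` ?P \<subseteq> linear_exts r (insert d A)"
    proof safe
      fix T k assume T: "T \<in> linear_exts r A" and k: "k \<in> {Suc (m T)..Suc (card A)}"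
      then show "insert_value A d (T, k) \<in> linear_exts r (insert d A)"
        using m[OF T, of k] max by (intro insert_value_linear_ext[OF A]) auto
    qed
    show "remove_value A d ` linear_exts r (insert d A) \<subseteq> ?P"
    proof safe
      fix U T k assume U: "U \<in> linear_exts r (insert d A)" and "(T, k) = remove_value A d U"
      then have Tk: "T = restrict (unskip (U d) \<circ> U) A" "k = U d"
        by (auto simp: remove_value_def)
      note rem = remove_value_linear_ext[OF A U]
      show T: "T \<in> linear_exts r A"
        using rem Tk by simp
      have "\<forall>x\<in>A. r x d \<longrightarrow> T x < k"
        using U rem(3) by (auto simp: Tk linear_exts_def unskip_less_self_iff)
      then show "k \<in> {Suc (m T)..Suc (card A)}"
        using m[OF T, of k] rem(2) Tk by auto
    qed
  qed
  then have "card (linear_exts r (insert d A)) = card ?P"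
    by (simp add: bij_betw_same_card)
  then show ?thesis
    by (simp add: finite_linear_exts[OF A(1)])
qed

section \<open>Existence of linear extensions\<close>

lemma linear_exts_nonempty:
  fixes r :: "'a \<Rightarrow> 'a \<Rightarrow> bool" and key :: "'a \<Rightarrow> 'b::linorder"
  assumes "finite A" and "inj_on key A"
    and key: "\<And>x y. x \<in> A \<Longrightarrow> y \<in> A \<Longrightarrow> r x y \<Longrightarrow> key x < key y"
  shows "linear_exts r A \<noteq> {}"
proof -
  \<comment> \<open>The rank of \<open>x\<close> when \<open>A\<close> is sorted by
    \<open>key\<close>, counted from 1.\<close>
  define T where "T = restrict (\<lambda>x. card {y\<in>A. key y \<le> key x}) A"
  have less: "T x < T y" if "x \<in> A" "y \<in> A" "key x < key y" for x y
  proof -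
    have "{z\<in>A. key z \<le> key x} \<subseteq> {z\<in>A. key z \<le> key y}"
      using that by (auto intro: order_trans)
    moreover have "y \<in> {z\<in>A. key z \<le> key y} - {z\<in>A. key z \<le> key x}"
      using that by auto
    ultimately have "{z\<in>A. key z \<le> key x} \<subset> {z\<in>A. key z \<le> key y}"
      by blast
    then show ?thesis
      using that assms(1) by (simp add: T_def psubset_card_mono)
  qed
  have "inj_on T A"
    by (metis assms(2) inj_on_def less linorder_neq_iff)
  moreover have "T ` A \<subseteq> {1..card A}"
    using assms(1) by (auto simp: T_def Suc_le_eq card_gt_0_iff intro: card_mono)
  ultimately have "bij_betw T A {1..card A}"
    by (metis bij_betw_def card_image card_atLeastAtMost card_subset_eq diff_Suc_1
        finite_atLeastAtMost)
  then have "T \<in> linear_exts r A"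
    using less key by (simp add: linear_exts_def T_def)
  then show ?thesis by blast
qed

section \<open>Standard Young tableaux as linear extensions\<close>

definition box_less :: "nat \<times> nat \<Rightarrow> nat \<times> nat \<Rightarrow> bool" where
  "box_less x y \<longleftrightarrow> fst x = fst y \<and> snd x < snd y \<or> snd x = snd y \<and> fst x < fst y"

text \<open>Row and column monotonicity together are monotonicity for \<open>box_less\<close>. This
  relation is not transitive, but \<open>linear_exts\<close> accepts any relation.\<close>

lemma skew_syt_eq_linear_exts: "skew_syt S = linear_exts box_less S"
  unfolding skew_syt_def linear_exts_def box_less_def by fastforce

lemma skew_syt_nonempty:
  assumes "finite S"
  shows "skew_syt S \<noteq> {}"
proof -
  \<comment> \<open>With \<open>M\<close> above every column index, \<open>fst x * M + snd x\<close>
    orders boxes lexicographically: row by row, each from left to right.\<close>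
  obtain M where M: "\<And>x. x \<in> S \<Longrightarrow> snd x < M"
    using assms finite_nat_set_iff_bounded[of "snd ` S"] by auto
  have key: "fst x * M + snd x < fst y * M + snd y"
    if "x \<in> S" "fst x < fst y" for x y :: "nat \<times> nat"
  proof -
    have "fst x * M + snd x < Suc (fst x) * M"
      using M that by simp
    also have "\<dots> \<le> fst y * M"
      using that by (intro mult_le_mono1) simp
    finally show ?thesis by simp
  qed
  show ?thesis
    unfolding skew_syt_eq_linear_exts
  proof (rule linear_exts_nonempty[OF assms, where key = "\<lambda>x. fst x * M + snd x"])
    show "inj_on (\<lambda>x. fst x * M + snd x) S"
    proof (rule inj_onI)
      fix x y assume "x \<in> S" "y \<in> S" "fst x * M + snd x = fst y * M + snd y"
      then show "x = y"
        using key[of x y] key[of y x] by (cases "fst x" "fst y" rule: linorder_cases)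
          (auto simp: prod_eq_iff)
    qed
  qed (auto simp: box_less_def intro: key)
qed

section \<open>Skew shapes and the expectation formula\<close>

lemma is_skew_shape_finite:
  assumes "is_skew_shape S"
  shows "finite S"
proof -
  obtain l m where S: "S = skew_diagram l m"
    using assms by (auto simp: is_skew_shape_def)
  have "S \<subseteq> (SIGMA i:{..length l}. {..part l i})"
    by (auto simp: S skew_diagram_def part_def split: if_splits)
  then show ?thesis
    by (rule finite_subset) auto
qed

text \<open>Index 0 is excluded because \<open>part l 0\<close> is the default value 0.\<close>

lemma part_antimono:
  assumes "is_partition l" "1 \<le> i" "i \<le> i'"
  shows "part l i' \<le> part l i"
  using assms unfolding part_def is_partition_def sorted_wrt_iff_nth_less
  by (cases "i = i'") auto

text \<open>Common source of both claims. Rows increase, so the boxes constraining the new box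
  reduce to the last box of row \<open>i\<close> and the boxes of the next column above row
  \<open>i\<close>; \<open>m T\<close> must have the same strict upper bounds as their
  entries.\<close>

lemma syt_expectation_add_box:
  assumes S: "is_skew_shape S" and ne: "shape_row S i \<noteq> {}"
    and m: "\<And>T k. T \<in> skew_syt S \<Longrightarrow>
      m T < k \<longleftrightarrow> T (i, last_col S i) < k \<and> (\<forall>i'<i. (i', last_col S i + 1) \<in> S \<longrightarrow>
        T (i', last_col S i + 1) < k)"
  shows "syt_expectation S m = real (card S) + 1 - real (num_syt (add_box S i)) / real (num_syt S)"
proof -
  obtain l u where l: "is_partition l" and S_eq: "S = skew_diagram l u"
    using S by (auto simp: is_skew_shape_def)
  let ?j = "last_col S i" and ?X = "skew_syt S"
  have j: "?j = part l i" and ij: "part u i < part l i"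
    using ne by (auto simp: S_eq last_col_skew_diagram) (auto simp: shape_row_skew_diagram)
  then have i: "1 \<le> i"
    by (auto simp: part_def split: if_splits)
  have mem: "(a, c) \<in> S \<longleftrightarrow> part u a < c \<and> c \<le> part l a" for a c
    by (simp add: S_eq skew_diagram_def)
  have row: "j' \<le> ?j" if "(i, j') \<in> S" for j'
    using that by (simp add: j mem)
  have b: "(i, ?j) \<in> S"
    using ij by (simp add: j mem)
  \<comment> \<open>Row \<open>i\<close> ends in column \<open>?j\<close> and lower rows are no
    longer, so column \<open>?j + 1\<close> has boxes only above row \<open>i\<close>. Hence the new
    box is maximal.\<close>
  have col: "i' < i" if "(i', ?j + 1) \<in> S" for i'
    using that part_antimono[OF l i, of i'] by (force simp: j mem not_le[symmetric])
  have fin: "finite S"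
    using S by (rule is_skew_shape_finite)
  have notin: "(i, ?j + 1) \<notin> S"
    using row by fastforce
  have "num_syt (add_box S i) = (\<Sum>T\<in>?X. Suc (card S) - m T)"
    unfolding num_syt_def add_box_def skew_syt_eq_linear_exts
  proof (rule card_linear_exts_insert[OF fin notin])
    show "\<not> box_less (i, ?j + 1) x" if "x \<in> S" for x
      using that row col by (cases x) (force simp: box_less_def)
    fix T k assume T: "T \<in> linear_exts box_less S"
    \<comment> \<open>The last box carries the largest entry of its row, so it alone accounts for
      all row constraints on the new box.\<close>
    have Tb: "T (i, j') \<le> T (i, ?j)" if "(i, j') \<in> S" for j'
    proof (cases "j' = ?j")
      case False
      then have "box_less (i, j') (i, ?j)"
        using row[OF that] by (simp add: box_less_def)
      then show ?thesis
        using T that b by (simp add: linear_exts_def less_imp_le)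
    qed simp
    show "(\<forall>x\<in>S. box_less x (i, ?j + 1) \<longrightarrow> T x < k) \<longleftrightarrow> m T < k" (is "?L \<longleftrightarrow> ?R")
    proof
      assume ?L
      then show ?R
        using b col T by (subst m) (auto simp: skew_syt_eq_linear_exts box_less_def)
    next
      assume ?R
      then have "T (i, ?j) < k" "\<And>i'. i' < i \<Longrightarrow> (i', ?j + 1) \<in> S \<Longrightarrow> T (i', ?j + 1) < k"
        using m[of T k] T by (auto simp: skew_syt_eq_linear_exts)
      then show ?L
        by (auto simp: box_less_def intro: le_less_trans[OF Tb])
    qed
  qed (simp add: box_less_def)
  \<comment> \<open>Needed to turn the truncated subtraction of naturals into real subtraction; it
    follows from the characterization of \<open>m T\<close> at
    \<open>k = Suc (card S)\<close>.\<close>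
  moreover have mle: "m T \<le> Suc (card S)" if T: "T \<in> ?X" for T
  proof -
    have "T x < Suc (card S)" if "x \<in> S" for x
      using T that bij_betwE[of T S "{1..card S}"] by (auto simp: skew_syt_def less_Suc_eq_le)
    then have "m T < Suc (card S)"
      using b by (subst m[OF T]) auto
    then show ?thesis by simp
  qed
  ultimately have "real (num_syt (add_box S i)) = (\<Sum>T\<in>?X. real (card S) + 1 - real (m T))"
    by (simp add: of_nat_diff algebra_simps)
  also have "\<dots> = (real (card S) + 1) * real (num_syt S) - (\<Sum>T\<in>?X. real (m T))"
    by (simp add: sum_subtractf num_syt_def)
  finally have N: "(\<Sum>T\<in>?X. real (m T))
      = (real (card S) + 1) * real (num_syt S) - real (num_syt (add_box S i))"
    by simp
  \<comment> \<open>Nonemptiness makes \<open>pmf_of_set\<close> the uniform distribution and the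
    denominator nonzero.\<close>
  have X: "finite ?X" "?X \<noteq> {}"
    using fin finite_linear_exts skew_syt_nonempty by (simp_all add: skew_syt_eq_linear_exts)
  then have "syt_expectation S m = (\<Sum>T\<in>?X. real (m T)) / real (num_syt S)"
    by (simp add: syt_expectation_def integral_pmf_of_set num_syt_def)
  moreover have "num_syt S \<noteq> 0"
    using X by (simp add: num_syt_def)
  ultimately show ?thesis
    by (simp add: N diff_divide_distrib)
qed

theorem lemma2p11:
  fixes \<sigma> :: "(nat \<times> nat) set" and n :: nat
  assumes "is_skew_shape \<sigma>" and "card \<sigma> = n"
  shows "(shape_row \<sigma> 1 \<noteq> {} \<longrightarrow>
           syt_expectation \<sigma> (\<lambda>T. T (1, last_col \<sigma> 1))
             = real n + 1 - real (num_syt (add_box \<sigma> 1)) / real (num_syt \<sigma>))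
       \<and> (\<forall>i j. shape_row \<sigma> i \<noteq> {} \<and> j = last_col \<sigma> i \<and> (i - 1, j + 1) \<in> \<sigma> \<longrightarrow>
           syt_expectation \<sigma> (\<lambda>T. max (T (i, j)) (T (i - 1, j + 1)))
             = real n + 1 - real (num_syt (add_box \<sigma> i)) / real (num_syt \<sigma>))"
proof (intro conjI impI allI)
  \<comment> \<open>Row 0 is empty. For the first row this removes the column condition, and in the
    second claim it forces \<open>i > 0\<close>, so that \<open>i - 1\<close> is a genuine
    predecessor.\<close>
  have row0: "(0, j) \<notin> \<sigma>" for j
    using assms(1) by (auto simp: is_skew_shape_def skew_diagram_def part_def)
  show "syt_expectation \<sigma> (\<lambda>T. T (1, last_col \<sigma> 1))
      = real n + 1 - real (num_syt (add_box \<sigma> 1)) / real (num_syt \<sigma>)"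
    if "shape_row \<sigma> 1 \<noteq> {}"
    unfolding assms(2)[symmetric]
    by (rule syt_expectation_add_box[OF assms(1) that]) (auto simp: row0)
  fix i j
  assume ij: "shape_row \<sigma> i \<noteq> {} \<and> j = last_col \<sigma> i \<and> (i - 1, j + 1) \<in> \<sigma>"
  then have c: "(i - 1, j + 1) \<in> \<sigma>" and j: "j = last_col \<sigma> i"
    by auto
  have i: "i - 1 < i"
    using ij row0 by (cases i) auto
  show "syt_expectation \<sigma> (\<lambda>T. max (T (i, j)) (T (i - 1, j + 1)))
      = real n + 1 - real (num_syt (add_box \<sigma> i)) / real (num_syt \<sigma>)"
    unfolding assms(2)[symmetric]
  proof (rule syt_expectation_add_box[OF assms(1)])
    show "shape_row \<sigma> i \<noteq> {}"
      using ij by simp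
    fix T k assume T: "T \<in> skew_syt \<sigma>"
    \<comment> \<open>Columns increase downwards, so among the boxes of column \<open>j + 1\<close>
      above row \<open>i\<close> the lowest one, \<open>c\<close>, has the largest entry.\<close>
    have "T (i', j + 1) \<le> T (i - 1, j + 1)" if "i' < i" "(i', j + 1) \<in> \<sigma>" for i'
      using T c that by (cases "i' = i - 1") (auto simp: skew_syt_def less_imp_le)
    then show "max (T (i, j)) (T (i - 1, j + 1)) < k \<longleftrightarrow> T (i, last_col \<sigma> i) < k \<and>
        (\<forall>i'<i. (i', last_col \<sigma> i + 1) \<in> \<sigma> \<longrightarrow> T (i', last_col \<sigma> i + 1) < k)"
      unfolding j[symmetric] using c i by (auto intro: le_less_trans)
  qed
qed

end
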